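(* Let $m$ and $r$ be positive integers and let $G_1,\dots,G_m$ be perfect groups with $d(G_i)\le r$ for all $i$. Then $d(G_1\times\dots\times G_m)\le r\lfloor 1+\log_2 m\rfloor$.
   Context: $d(G)$ denotes the minimal cardinality of a generating set of the group $G$. A group $G$ is perfect if $G=[G,G]$. *)

theory Defs
  imports Complex_Main "HOL-Library.Extended_Nat" "HOL-Algebra.Generated_Groups"
    "HOL-Algebra.Product_Groups"
begin

(* Minimal cardinality of a generating set.  The infimum of the empty set in enat is \<infinity>,
   so the value is \<infinity> exactly when G is not finitely generated; distinct infinite cardinals
   are not distinguished. *)
definition min_gens :: "('a, 'b) monoid_scheme \<Rightarrow> enat" where
  "min_gens G =
    (INF S \<in> {S. S \<subseteq> carrier G \<and> finite S \<and> generate G S = carrier G}. enat (card S))"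

lemma min_gens_le_enat_iff:
  "min_gens G \<le> enat n \<longleftrightarrow>
    (\<exists>S. S \<subseteq> carrier G \<and> finite S \<and> generate G S = carrier G \<and> card S \<le> n)"
    (is "?L \<longleftrightarrow> ?R")
proof
  let ?A = "{S. S \<subseteq> carrier G \<and> finite S \<and> generate G S = carrier G}"
  assume L: ?L
  have "?A \<noteq> {}"
  proof
    assume "?A = {}"
    then have "min_gens G = \<infinity>"
      unfolding min_gens_def by (simp only: image_empty Inf_empty top_enat_def)
    with L show False by simp
  qed
  then obtain S\<^sub>0 where "S\<^sub>0 \<in> ?A"
    by blast
  then have "Inf ((\<lambda>S. enat (card S)) ` ?A) \<in> (\<lambda>S. enat (card S)) ` ?A"
    by (intro wellorder_InfI[of "enat (card S\<^sub>0)"] imageI)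
  then obtain S where S: "S \<in> ?A" "min_gens G = enat (card S)"
    unfolding min_gens_def by (elim imageE)
  with L show ?R
    by auto
next
  assume ?R
  then show ?L
    unfolding min_gens_def by (auto intro: INF_lower2)
qed

definition perfect_group :: "('a, 'b) monoid_scheme \<Rightarrow> bool" where
  "perfect_group G \<longleftrightarrow> group G \<and> derived G (carrier G) = carrier G"

end

theory Submission
  imports Defs
begin

text \<open>
  Since \<open>m < 2 ^ k\<close> for \<open>k = \<lfloor>1 + log 2 m\<rfloor>\<close>, the binary expansions of \<open>1, \<dots>, m\<close> are distinct
  nonempty sets of bit positions below \<open>k\<close>. Let \<open>g i 0, \<dots>, g i (r - 1)\<close> generate \<open>G i\<close>. For every
  bit position \<open>j\<close> and every \<open>s < r\<close> take the tuple with entry \<open>g i s\<close> at those \<open>i\<close> that have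
  bit \<open>j\<close> and \<open>1\<close> elsewhere, and let \<open>H\<close> be the subgroup generated by these \<open>r * k\<close> tuples.

  If a coordinate \<open>i\<close> can be prescribed arbitrarily by elements of \<open>H\<close> supported in \<open>A\<close>, and
  also by elements of \<open>H\<close> supported in \<open>B\<close>, then by commutators it can be prescribed by elements
  of \<open>H\<close> supported in \<open>A \<inter> B\<close>, because \<open>G i\<close> is perfect. Intersecting over all bits of \<open>i\<close> leaves
  the support inside the set of numbers whose bits include those of \<open>i\<close>; all of them are at
  least \<open>i\<close>. Hence \<open>H\<close> is the whole product, by a triangular elimination starting from \<open>i = m\<close>.
\<close>

section \<open>Elements of a subgroup with prescribed support\<close>

text \<open>The set \<open>A\<close> need not lie inside \<open>I\<close>: only entries at
  \<open>I - A\<close> are constrained, so sets such as \<open>{i..}\<close> or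
  \<open>{l. bit l j}\<close> can be used as they stand.\<close>

definition supported_in ::
    "'i set \<Rightarrow> ('i \<Rightarrow> ('a, 'b) monoid_scheme) \<Rightarrow> ('i \<Rightarrow> 'a) set \<Rightarrow> 'i set \<Rightarrow> ('i \<Rightarrow> 'a) set"
  where "supported_in I G H A = {h \<in> H. \<forall>i \<in> I - A. h i = \<one>\<^bsub>G i\<^esub>}"

lemma supported_in_mono: "A \<subseteq> B \<Longrightarrow> supported_in I G H A \<subseteq> supported_in I G H B"
  by (auto simp: supported_in_def)

lemma subgroup_supported_in:
  assumes G: "\<And>i. i \<in> I \<Longrightarrow> group (G i)" and H: "subgroup H (product_group I G)"
  shows "subgroup (supported_in I G H A) (product_group I G)"
proof -
  interpret P: group "product_group I G"
    using G by simp
  have HP: "h \<in> carrier (product_group I G)" if "h \<in> H" for h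
    using H that by (rule subgroup.mem_carrier)
  show ?thesis
  proof (rule P.subgroupI)
    show "supported_in I G H A \<subseteq> carrier (product_group I G)"
      using HP by (auto simp: supported_in_def simp del: carrier_product_group)
    have "\<one>\<^bsub>product_group I G\<^esub> \<in> supported_in I G H A"
      using subgroup.one_closed[OF H] by (auto simp: supported_in_def)
    then show "supported_in I G H A \<noteq> {}"
      by blast
  next
    fix a assume a: "a \<in> supported_in I G H A"
    then have "inv\<^bsub>product_group I G\<^esub> a \<in> H"
      using subgroup.m_inv_closed[OF H] by (simp add: supported_in_def)
    moreover have "inv\<^bsub>product_group I G\<^esub> a = (\<lambda>i\<in>I. inv\<^bsub>G i\<^esub> a i)"
      using a HP G by (intro inv_product_group) (auto simp: supported_in_def)
    ultimately show "inv\<^bsub>product_group I G\<^esub> a \<in> supported_in I G H A"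
      using a G by (auto simp: supported_in_def group.is_monoid monoid.inv_one)
  next
    fix a b assume "a \<in> supported_in I G H A" "b \<in> supported_in I G H A"
    then show "a \<otimes>\<^bsub>product_group I G\<^esub> b \<in> supported_in I G H A"
      using subgroup.m_closed[OF H, of a b] G
      by (auto simp: supported_in_def group.is_monoid)
  qed
qed

lemma group_hom_product_group_proj:
  assumes "\<And>i. i \<in> I \<Longrightarrow> group (G i)" "i \<in> I"
  shows "group_hom (product_group I G) (G i) (\<lambda>f. f i)"
  using assms by (auto simp: group_hom_def group_hom_axioms_def hom_def)

text \<open>Because of this, surjectivity onto \<open>G i\<close> only has to be checked on
  generators of \<open>G i\<close>: on commutators when supports are intersected, on the elements
  \<open>g i s\<close> for a single bit.\<close>

lemma subgroup_proj_supported_in: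
  assumes "\<And>i. i \<in> I \<Longrightarrow> group (G i)" "subgroup H (product_group I G)" "i \<in> I"
  shows "subgroup ((\<lambda>h. h i) ` supported_in I G H A) (G i)"
proof -
  interpret group_hom "product_group I G" "G i" "\<lambda>f. f i"
    using assms(1,3) by (rule group_hom_product_group_proj)
  show ?thesis
    using assms(1,2) by (intro subgroup_img_is_subgroup subgroup_supported_in)
qed

section \<open>Commutators and intersections of supports\<close>

lemma product_group_commutator:
  assumes G: "\<And>i. i \<in> I \<Longrightarrow> group (G i)"
    and ab: "a \<in> carrier (product_group I G)" "b \<in> carrier (product_group I G)"
    and i: "i \<in> I"
  shows "(a \<otimes>\<^bsub>product_group I G\<^esub> b \<otimes>\<^bsub>product_group I G\<^esub> inv\<^bsub>product_group I G\<^esub> a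
      \<otimes>\<^bsub>product_group I G\<^esub> inv\<^bsub>product_group I G\<^esub> b) i
    = a i \<otimes>\<^bsub>G i\<^esub> b i \<otimes>\<^bsub>G i\<^esub> inv\<^bsub>G i\<^esub> (a i) \<otimes>\<^bsub>G i\<^esub> inv\<^bsub>G i\<^esub> (b i)"
proof -
  have "inv\<^bsub>product_group I G\<^esub> a = (\<lambda>i\<in>I. inv\<^bsub>G i\<^esub> a i)"
      "inv\<^bsub>product_group I G\<^esub> b = (\<lambda>i\<in>I. inv\<^bsub>G i\<^esub> b i)"
    using ab G by (auto intro!: inv_product_group)
  then show ?thesis
    using i by simp
qed

text \<open>Take \<open>a\<close> supported in \<open>A\<close> and \<open>b\<close> supported in
  \<open>B\<close> with prescribed entries at \<open>i\<close>. Their commutator has the commutator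
  of these entries at \<open>i\<close>, and such commutators generate the perfect group
  \<open>G i\<close>.\<close>

lemma proj_supported_in_Int:
  assumes G: "\<And>i. i \<in> I \<Longrightarrow> group (G i)" and H: "subgroup H (product_group I G)"
    and i: "i \<in> I" and perfect: "perfect_group (G i)"
    and A: "(\<lambda>h. h i) ` supported_in I G H A = carrier (G i)"
    and B: "(\<lambda>h. h i) ` supported_in I G H B = carrier (G i)"
  shows "(\<lambda>h. h i) ` supported_in I G H (A \<inter> B) = carrier (G i)"
proof
  let ?P = "product_group I G"
  let ?D = "(\<lambda>h. h i) ` supported_in I G H (A \<inter> B)"
  interpret Gi: group "G i"
    using G i by blast
  have D: "subgroup ?D (G i)"
    using G H i by (rule subgroup_proj_supported_in)
  then show "?D \<subseteq> carrier (G i)"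
    by (rule subgroup.subset)
  have "derived_set (G i) (carrier (G i)) \<subseteq> ?D"
  proof clarify
    fix x y assume x: "x \<in> carrier (G i)" and y: "y \<in> carrier (G i)"
    obtain a where a: "a \<in> supported_in I G H A" "x = a i"
      using x unfolding A[symmetric] by (rule imageE)
    obtain b where b: "b \<in> supported_in I G H B" "y = b i"
      using y unfolding B[symmetric] by (rule imageE)
    let ?c = "a \<otimes>\<^bsub>?P\<^esub> b \<otimes>\<^bsub>?P\<^esub> inv\<^bsub>?P\<^esub> a \<otimes>\<^bsub>?P\<^esub> inv\<^bsub>?P\<^esub> b"
    have abH: "a \<in> H" "b \<in> H"
      using a b by (auto simp: supported_in_def)
    then have abP: "a \<in> carrier ?P" "b \<in> carrier ?P"
      using subgroup.mem_carrier[OF H] by blast+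
    have c: "?c l = a l \<otimes>\<^bsub>G l\<^esub> b l \<otimes>\<^bsub>G l\<^esub> inv\<^bsub>G l\<^esub> (a l) \<otimes>\<^bsub>G l\<^esub> inv\<^bsub>G l\<^esub> (b l)"
      if "l \<in> I" for l
      using G abP that by (rule product_group_commutator)
    have "?c \<in> H"
      using abH by (intro subgroup.m_closed[OF H] subgroup.m_inv_closed[OF H])
    moreover have "?c l = \<one>\<^bsub>G l\<^esub>" if l: "l \<in> I - A \<inter> B" for l
    proof -
      interpret Gl: group "G l"
        using G l by blast
      have "a l \<in> carrier (G l)" "b l \<in> carrier (G l)"
        using abP l by auto
      \<comment> \<open>Outside \<open>A \<inter> B\<close> one of the two entries is trivial, and a
        commutator with the identity is the identity.\<close>
      moreover have "a l = \<one>\<^bsub>G l\<^esub> \<or> b l = \<one>\<^bsub>G l\<^esub>"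
        using a b l by (auto simp: supported_in_def)
      ultimately show ?thesis
        using l by (auto simp: c simp del: mult_product_group)
    qed
    ultimately have "?c \<in> supported_in I G H (A \<inter> B)"
      unfolding supported_in_def by blast
    then have "?c i \<in> ?D"
      by (rule imageI)
    then show "x \<otimes>\<^bsub>G i\<^esub> y \<otimes>\<^bsub>G i\<^esub> inv\<^bsub>G i\<^esub> x \<otimes>\<^bsub>G i\<^esub> inv\<^bsub>G i\<^esub> y \<in> ?D"
      by (simp only: c[OF i] a b)
  qed
  then have "derived (G i) (carrier (G i)) \<subseteq> ?D"
    unfolding derived_def using D by (rule Gi.generate_subgroup_incl)
  then show "carrier (G i) \<subseteq> ?D"
    using perfect by (simp add: perfect_group_def)
qed

text \<open>Induction on \<open>J\<close> starts from a singleton: for empty \<open>J\<close> the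
  intersection is \<open>UNIV\<close>, and the claim would be that all of \<open>H\<close> projects
  onto \<open>G i\<close>.\<close>

lemma proj_supported_in_INT:
  assumes G: "\<And>i. i \<in> I \<Longrightarrow> group (G i)" and H: "subgroup H (product_group I G)"
    and i: "i \<in> I" and perfect: "perfect_group (G i)"
    and J: "finite J" "J \<noteq> {}"
    and A: "\<And>j. j \<in> J \<Longrightarrow> (\<lambda>h. h i) ` supported_in I G H (A j) = carrier (G i)"
  shows "(\<lambda>h. h i) ` supported_in I G H (\<Inter>j\<in>J. A j) = carrier (G i)"
  using J A
proof (induction J rule: finite_ne_induct)
  case (insert j J)
  have "(\<lambda>h. h i) ` supported_in I G H (A j \<inter> (\<Inter>j\<in>J. A j)) = carrier (G i)"
    using insert by (intro proj_supported_in_Int G H i perfect) auto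
  then show ?case
    by simp
qed simp

section \<open>Triangular elimination\<close>

text \<open>Dividing \<open>f\<close> by an element of \<open>H\<close> with the same first possibly
  nontrivial entry moves the support from \<open>{i..}\<close> to \<open>{Suc i..}\<close>; after
  \<open>m\<close> such divisions only the identity remains.\<close>

lemma triangular_subgroup_eq_carrier:
  fixes G :: "nat \<Rightarrow> ('a, 'b) monoid_scheme"
  assumes G: "\<And>i. i \<in> {1..m} \<Longrightarrow> group (G i)"
    and H: "subgroup H (product_group {1..m} G)"
    and proj: "\<And>i. i \<in> {1..m} \<Longrightarrow> (\<lambda>h. h i) ` supported_in {1..m} G H {i..} = carrier (G i)"
  shows "H = carrier (product_group {1..m} G)"
proof
  let ?P = "product_group {1..m} G"
  interpret P: group ?P
    using G by (rule product_group)
  show "H \<subseteq> carrier ?P"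
    using H by (rule subgroup.subset)
  \<comment> \<open>The induction runs downwards from \<open>Suc m\<close>, where no index is left
    in the support; the case \<open>i = 1\<close> puts no condition on \<open>f\<close>.\<close>
  have elim: "f \<in> H"
    if "f \<in> supported_in {1..m} G (carrier ?P) {i..}" "1 \<le> i" "i \<le> Suc m" for f i
    using that(3,1,2)
  proof (induction i arbitrary: f rule: inc_induct)
    case base
    then have "f = \<one>\<^bsub>?P\<^esub>"
      by (auto simp: supported_in_def fun_eq_iff PiE_iff extensional_def)
    then show ?case
      using subgroup.one_closed[OF H] by (simp del: one_product_group)
  next
    case (step i)
    then have i: "i \<in> {1..m}"
      by simp
    have f: "f \<in> carrier ?P"
      using step.prems by (simp add: supported_in_def)
    then have "f i \<in> carrier (G i)"
      using i by auto
    then obtain h where h: "h \<in> supported_in {1..m} G H {i..}" "f i = h i"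
      unfolding proj[OF i, symmetric] by (rule imageE)
    have hH: "h \<in> H"
      using h by (simp add: supported_in_def)
    then have hP: "h \<in> carrier ?P"
      using subgroup.mem_carrier[OF H] by blast
    let ?q = "f \<otimes>\<^bsub>?P\<^esub> inv\<^bsub>?P\<^esub> h"
    have inv_h: "inv\<^bsub>?P\<^esub> h = (\<lambda>i\<in>{1..m}. inv\<^bsub>G i\<^esub> h i)"
      using hP G by (intro inv_product_group) auto
    have "?q l = \<one>\<^bsub>G l\<^esub>" if l: "l \<in> {1..m} - {Suc i..}" for l
    proof -
      interpret Gl: group "G l"
        using G l by blast
      \<comment> \<open>Both entries are trivial for \<open>l < i\<close>, and at
        \<open>l = i\<close> they agree by the choice of \<open>h\<close>.\<close>
      have "h l = f l"
        using h step.prems l by (cases "l = i") (auto simp: supported_in_def)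
      moreover have "f l \<in> carrier (G l)"
        using f l by auto
      ultimately show ?thesis
        unfolding inv_h using l by simp
    qed
    then have "?q \<in> supported_in {1..m} G (carrier ?P) {Suc i..}"
      using f hP unfolding supported_in_def by blast
    then have "?q \<in> H"
      by (rule step.IH) simp
    then have "?q \<otimes>\<^bsub>?P\<^esub> h \<in> H"
      using hH by (rule subgroup.m_closed[OF H])
    moreover have "?q \<otimes>\<^bsub>?P\<^esub> h = f"
      using f hP by (simp add: P.m_assoc
          del: mult_product_group carrier_product_group one_product_group One_nat_def)
    ultimately show ?case
      by simp
  qed
  show "carrier ?P \<subseteq> H"
    by (auto simp: supported_in_def intro!: elim[of _ 1] simp del: carrier_product_group)
qed

section \<open>Binary digits\<close>

text \<open>Halving shifts the bits down by one, so the hypothesis passes to \<open>a div 2\<close>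
  and \<open>b div 2\<close>; bit \<open>0\<close> then compares the parities.\<close>

lemma bit_subset_imp_le:
  fixes a b :: nat
  assumes "\<And>j. bit a j \<Longrightarrow> bit b j"
  shows "a \<le> b"
  using assms
proof (induction a arbitrary: b rule: less_induct)
  case (less a)
  show ?case
  proof (cases "a = 0")
    case False
    have "a div 2 \<le> b div 2"
      using False less.prems[of "Suc _"] by (intro less.IH) (auto simp: bit_Suc)
    moreover have "odd a \<Longrightarrow> odd b"
      using less.prems[of 0] by (simp add: bit_0)
    ultimately show ?thesis
      by (cases "odd a"; cases "odd b") (auto elim!: oddE evenE)
  qed simp
qed

lemma bit_nat_imp_less:
  fixes a :: nat
  assumes "bit a j" "a < 2 ^ k"
  shows "j < k"
  by (metis assms bit_take_bit_iff take_bit_nat_eq_self_iff)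

lemma less_two_power_floor_log:
  assumes "m > 0"
  shows "m < 2 ^ nat \<lfloor>1 + log 2 (real m)\<rfloor>"
proof -
  let ?k = "nat \<lfloor>1 + log 2 (real m)\<rfloor>"
  have "0 \<le> log 2 (real m)"
    using assms by simp
  \<comment> \<open>The value \<open>\<lfloor>1 + x\<rfloor>\<close> exceeds \<open>x\<close>
    strictly even for integral \<open>x\<close>, which covers the case that \<open>m\<close> is a
    power of two.\<close>
  then have "log 2 (real m) < real ?k"
    by linarith
  then have "real m < 2 powr real ?k"
    using assms by (simp add: log_less_iff)
  then have "real m < real (2 ^ ?k)"
    by (simp add: powr_realpow)
  then show ?thesis
    by linarith
qed

text \<open>Padding a generating set with the identity gives every factor a family over the same
  index set \<open>{..<r}\<close>, so that one tuple can take the \<open>s\<close>-th generator in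
  many factors at once.\<close>

lemma min_gens_le_imp_generating_family:
  assumes "group G" "min_gens G \<le> enat r"
  obtains g where "\<And>s. g s \<in> carrier G" "generate G (g ` {..<r}) = carrier G"
proof -
  interpret group G
    by fact
  obtain S where S: "S \<subseteq> carrier G" "finite S" "generate G S = carrier G" "card S \<le> r"
    using assms(2) by (auto simp: min_gens_le_enat_iff)
  obtain e where e: "bij_betw e {0..<card S} S"
    using ex_bij_betw_nat_finite[OF S(2)] by blast
  define g where "g s = (if s < card S then e s else \<one>\<^bsub>G\<^esub>)" for s
  have g: "g s \<in> carrier G" for s
    using bij_betwE[OF e] S(1) by (auto simp: g_def)
  have "S \<subseteq> g ` {..<r}"
  proof
    fix x assume "x \<in> S"
    then obtain s where "s < card S" "e s = x"
      using bij_betw_imp_surj_on[OF e] by (metis atLeastLessThan_iff imageE)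
    then show "x \<in> g ` {..<r}"
      using S(4) by (auto simp: g_def intro!: image_eqI[of _ _ s])
  qed
  from mono_generate[OF this] have "generate G (g ` {..<r}) = carrier G"
    using S(3) g generate_incl[of "g ` {..<r}"] by blast
  with g that show thesis
    by blast
qed

theorem corollary1p3:
  fixes m r :: nat and G :: "nat \<Rightarrow> ('a, 'b) monoid_scheme"
  assumes "m > 0" and "r > 0"
    and "\<And>i. i \<in> {1..m} \<Longrightarrow> perfect_group (G i)"
    and "\<And>i. i \<in> {1..m} \<Longrightarrow> min_gens (G i) \<le> enat r"
  shows "min_gens (product_group {1..m} G) \<le> enat (r * nat \<lfloor>1 + log 2 (real m)\<rfloor>)"
proof -
  let ?P = "product_group {1..m} G"
  define k where "k = nat \<lfloor>1 + log 2 (real m)\<rfloor>"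
  have G: "group (G i)" if "i \<in> {1..m}" for i
    using assms(3)[OF that] by (simp add: perfect_group_def)
  interpret P: group ?P
    using G by (rule product_group)
  have "\<exists>g. (\<forall>s. g s \<in> carrier (G i)) \<and> generate (G i) (g ` {..<r}) = carrier (G i)"
    if "i \<in> {1..m}" for i
    using min_gens_le_imp_generating_family[OF G assms(4)] that by metis
  then obtain g where g: "\<And>i s. i \<in> {1..m} \<Longrightarrow> g i s \<in> carrier (G i)"
    and gen: "\<And>i. i \<in> {1..m} \<Longrightarrow> generate (G i) (g i ` {..<r}) = carrier (G i)"
    by metis
  define x where "x = (\<lambda>(s, j). \<lambda>i\<in>{1..m}. if bit i j then g i s else \<one>\<^bsub>G i\<^esub>)"
  define S where "S = x ` ({..<r} \<times> {..<k})"
  define H where "H = generate ?P S"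
  have SP: "S \<subseteq> carrier ?P"
    using g G by (auto simp: S_def x_def group.is_monoid)
  then have H: "subgroup H ?P"
    unfolding H_def by (rule P.generate_is_subgroup)
  have proj_bit: "(\<lambda>h. h i) ` supported_in {1..m} G H {l. bit l j} = carrier (G i)" (is "?D = _")
    if i: "i \<in> {1..m}" and j: "bit i j" "j < k" for i j
  proof
    interpret Gi: group "G i"
      using G i by blast
    have D: "subgroup ?D (G i)"
      using G H i by (rule subgroup_proj_supported_in)
    then show "?D \<subseteq> carrier (G i)"
      by (rule subgroup.subset)
    \<comment> \<open>The tuple \<open>x (s, j)\<close> is a witness: it vanishes where bit
      \<open>j\<close> is absent, and its entry at \<open>i\<close> is \<open>g i s\<close> because
      \<open>i\<close> has bit \<open>j\<close>.\<close>
    have "g i s \<in> ?D" if "s < r" for s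
    proof (rule image_eqI)
      show "g i s = x (s, j) i"
        using i j by (simp add: x_def)
      have "x (s, j) \<in> H"
        using that j unfolding H_def S_def by (intro generate.incl) auto
      then show "x (s, j) \<in> supported_in {1..m} G H {l. bit l j}"
        by (auto simp: supported_in_def x_def)
    qed
    then have "generate (G i) (g i ` {..<r}) \<subseteq> ?D"
      using D by (intro Gi.generate_subgroup_incl) auto
    then show "carrier (G i) \<subseteq> ?D"
      using gen i by simp
  qed
  have "(\<lambda>h. h i) ` supported_in {1..m} G H {i..} = carrier (G i)" (is "?D = _")
    if i: "i \<in> {1..m}" for i
  proof
    show "?D \<subseteq> carrier (G i)"
      using G H i by (intro subgroup.subset subgroup_proj_supported_in)
    have "i \<le> m"
      using i by simp
    also have "m < 2 ^ k"
      unfolding k_def using assms(1) by (rule less_two_power_floor_log)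
    finally have "i < 2 ^ k" .
    then have less: "j < k" if "bit i j" for j
      using that by (rule bit_nat_imp_less[rotated])
    \<comment> \<open>Here it matters that the numbering starts at \<open>1\<close>: a number
      without bits would be at most \<open>0\<close>.\<close>
    have "{j. bit i j} \<noteq> {}"
      using bit_subset_imp_le[of i 0] i by force
    moreover have "finite {j. bit i j}"
      using less by (auto intro: finite_subset[of _ "{..<k}"])
    ultimately have "(\<lambda>h. h i) ` supported_in {1..m} G H (\<Inter>j\<in>{j. bit i j}. {l. bit l j})
        = carrier (G i)"
      using i less by (intro proj_supported_in_INT G H assms(3) proj_bit) auto
    moreover have "(\<Inter>j\<in>{j. bit i j}. {l. bit l j}) \<subseteq> {i..}"
      by (auto intro: bit_subset_imp_le)
    ultimately show "carrier (G i) \<subseteq> ?D"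
      using supported_in_mono by (metis image_mono)
  qed
  with G H have "generate ?P S = carrier ?P"
    unfolding H_def by (intro triangular_subgroup_eq_carrier) auto
  moreover have "finite S"
    by (simp add: S_def)
  \<comment> \<open>Only an upper bound is claimed, since different pairs \<open>(s, j)\<close> may
    give the same tuple.\<close>
  moreover have "card S \<le> r * k"
    unfolding S_def by (rule order_trans[OF card_image_le]) simp_all
  ultimately show ?thesis
    using SP unfolding min_gens_le_enat_iff k_def by blast
qed

end
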